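(* Let $\theta>1$ be an algebraic integer which has at least one conjugate (different from $\theta$) outside the unit circle, and let $\lambda=\theta^{-1}$. Then for any $p\in(0,1)$ there exists $\alpha>0$ such that $$\sup_{\xi\in\mathbb R}\,|\widehat{\nu}_\lambda^{\,p}(\xi)|\,(\log(2+|\xi|))^{\alpha}<\infty .$$
   Context: For $\lambda\in(0,1)$ and $p\in(0,1)$, the (biased) Bernoulli convolution measure $\nu_\lambda^p$ is the distribution of the random series $\sum_{n=0}^\infty\pm\lambda^n$, where the signs $+$ and $-$ are chosen randomly and independently with probabilities $p$ and $1-p$ respectively. Its Fourier transform is $\widehat\nu_\lambda^{\,p}(\xi)=\int_{\mathbb R}e^{-2\pi i\xi x}\,d\nu_\lambda^p(x)=\prod_{n=0}^\infty\bigl(p\,e^{-2\pi i\lambda^n\xi}+(1-p)e^{2\pi i\lambda^n\xi}\bigr)$. "Conjugate" means Galois conjugate; "outside the unit circle" means of absolute value greater than $1$. *)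

theory Defs
  imports "HOL-Probability.Probability"
    "HOL-Computational_Algebra.Computational_Algebra"
begin

(* The irreducible polynomial q is, up to a unit of rat, the minimal polynomial of x over the
   rationals, and z ranges over its complex roots; x counts as one of its own conjugates. *)
definition galois_conjugate :: "complex \<Rightarrow> complex \<Rightarrow> bool" where
  "galois_conjugate x z \<longleftrightarrow>
     (\<exists>q :: rat poly. irreducible q \<and>
        poly (map_poly of_rat q) x = 0 \<and> poly (map_poly of_rat q) z = 0)"

(* Independent signs: coordinate n is True (sign +) with probability p. *)
definition sign_space :: "real \<Rightarrow> (nat \<Rightarrow> bool) measure" where
  "sign_space p = PiM UNIV (\<lambda>_. measure_pmf (bernoulli_pmf p))"

definition random_series :: "real \<Rightarrow> (nat \<Rightarrow> bool) \<Rightarrow> real" where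
  "random_series l \<omega> = (\<Sum>n. (if \<omega> n then 1 else - 1) * l ^ n)"

definition bernoulli_convolution :: "real \<Rightarrow> real \<Rightarrow> real measure" where
  "bernoulli_convolution p l = distr (sign_space p) borel (random_series l)"

(* distr yields a genuine image measure only for measurable maps. *)
lemma random_series_measurable [measurable]:
  "random_series l \<in> borel_measurable (sign_space p)"
  unfolding random_series_def sign_space_def by measurable

lemma prob_space_bernoulli_convolution: "prob_space (bernoulli_convolution p l)"
proof -
  interpret product_prob_space "\<lambda>_::nat. measure_pmf (bernoulli_pmf p)" UNIV
    by standard
  have "prob_space (sign_space p)"
    unfolding sign_space_def by (rule P.prob_space_axioms)
  then show ?thesis
    unfolding bernoulli_convolution_def
    by (rule prob_space.prob_space_distr) (rule random_series_measurable)
qed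

(* char M uses the kernel exp (i t x); here the normalisation is exp (- 2 pi i xi x). *)
definition fourier_transform :: "real measure \<Rightarrow> real \<Rightarrow> complex" where
  "fourier_transform M \<xi> =
     (CLINT x|M. exp (- 2 * of_real pi * \<i> * of_real \<xi> * of_real x))"

end

theory Submission
  imports Defs "HOL-Computational_Algebra.Field_as_Ring"
begin

text \<open>Up to sign, \<open>2 \<xi> = \<theta> ^ N * y\<close> with \<open>1 \<le> y < \<theta>\<close>, and the modulus of the Fourier transform is
  at most a product over \<open>n \<le> N\<close> of factors that are bounded away from \<open>1\<close> whenever \<open>\<theta> ^ n * y\<close>
  is far from the integers. So it suffices that among \<open>n \<le> N\<close> there are at least a constant times
  \<open>log N\<close> such indices, which holds if every block \<open>{k..M * k}\<close> contains one.

  Let \<open>K n\<close> be the integer nearest to \<open>\<theta> ^ n * y\<close>. If all \<open>\<theta> ^ n * y\<close> in a block are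
  close to integers, then \<open>K\<close> satisfies there the linear recurrence given by the minimal polynomial
  \<open>q\<close> of \<open>\<theta>\<close>. The functional given by the coefficients of \<open>q(X) / (X - z)\<close>, where \<open>z\<close> is the
  conjugate outside the unit circle, is multiplied by \<open>z\<close> under the shift and annihilates the
  sequence \<open>\<theta> ^ n * y\<close>, so that its values on \<open>K\<close> are bounded while they grow like \<open>\<bar>z\<bar> ^ n\<close>.
  But its value at \<open>k\<close> is a nonzero integer combination of powers of \<open>z\<close> with coefficients
  \<open>O(\<theta> ^ k)\<close>, so by a Liouville inequality it is at least \<open>c * \<theta> ^ (- D * k)\<close>. Hence the length of
  the block is \<open>O(k)\<close>.\<close>

section \<open>A Liouville inequality for algebraic integers\<close>

locale integral_element =
  fixes z :: complex and m :: nat and c :: "nat \<Rightarrow> int"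
  assumes degree_pos: "m > 0"
    and power_degree: "z ^ m = (\<Sum>j<m. of_int (c j) * z ^ j)"
begin

text \<open>The relation for \<open>z ^ m\<close> need not be minimal, so an element of the ring
  Z[z] may have several coordinate vectors; membership asks for one of height at most
  \<open>B\<close>.\<close>

definition int_span :: "nat \<Rightarrow> complex set" where
  "int_span B = {\<Sum>j<m. of_int (a j) * z ^ j | a. \<forall>j<m. \<bar>a j\<bar> \<le> int B}"

definition growth :: nat where
  "growth = 1 + (\<Sum>j<m. nat \<bar>c j\<bar>)"

lemma int_spanI: "(\<And>j. j < m \<Longrightarrow> \<bar>a j\<bar> \<le> int B) \<Longrightarrow> (\<Sum>j<m. of_int (a j) * z ^ j) \<in> int_span B"
  unfolding int_span_def by blast

lemma int_span_mono: "x \<in> int_span B \<Longrightarrow> B \<le> B' \<Longrightarrow> x \<in> int_span B'"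
  unfolding int_span_def by fastforce

lemma zero_in_int_span: "0 \<in> int_span B"
  unfolding int_span_def by (auto intro!: exI[of _ "\<lambda>_. 0"])

lemma one_in_int_span: "1 \<in> int_span 1"
proof -
  have "(\<Sum>j<m. of_int (if j = 0 then 1 else 0) * z ^ j) = (\<Sum>j<m. if j = 0 then 1 else 0)"
    by (intro sum.cong) auto
  then have "(\<Sum>j<m. of_int (if j = 0 then 1 else 0) * z ^ j) = 1"
    using degree_pos by simp
  then show ?thesis
    unfolding int_span_def by (auto intro!: exI[of _ "\<lambda>j. if j = 0 then 1 else 0"])
qed

lemma int_span_add:
  assumes "x \<in> int_span B" "y \<in> int_span B'"
  shows "x + y \<in> int_span (B + B')"
proof -
  obtain a b where a: "x = (\<Sum>j<m. of_int (a j) * z ^ j)" "\<forall>j<m. \<bar>a j\<bar> \<le> int B"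
    and b: "y = (\<Sum>j<m. of_int (b j) * z ^ j)" "\<forall>j<m. \<bar>b j\<bar> \<le> int B'"
    using assms unfolding int_span_def by blast
  have "x + y = (\<Sum>j<m. of_int (a j + b j) * z ^ j)"
    unfolding a(1) b(1) by (simp add: sum.distrib algebra_simps)
  also have "\<dots> \<in> int_span (B + B')"
    using a(2) b(2) by (intro int_spanI) (auto intro: order_trans[OF abs_triangle_ineq] add_mono)
  finally show ?thesis .
qed

lemma int_span_scale:
  assumes "x \<in> int_span B" "\<bar>t\<bar> \<le> int T"
  shows "of_int t * x \<in> int_span (T * B)"
proof -
  obtain a where a: "x = (\<Sum>j<m. of_int (a j) * z ^ j)" "\<forall>j<m. \<bar>a j\<bar> \<le> int B"
    using assms unfolding int_span_def by blast
  have "of_int t * x = (\<Sum>j<m. of_int (t * a j) * z ^ j)"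
    unfolding a(1) by (simp add: sum_distrib_left algebra_simps)
  also have "\<dots> \<in> int_span (T * B)"
    using a(2) assms(2) by (intro int_spanI) (auto simp: abs_mult intro: mult_mono)
  finally show ?thesis .
qed

lemma int_span_sum:
  assumes "\<And>i. i < n \<Longrightarrow> f i \<in> int_span B"
  shows "(\<Sum>i<n. f i) \<in> int_span (n * B)"
  using assms
proof (induction n)
  case 0
  then show ?case by (simp add: zero_in_int_span)
next
  case (Suc n)
  then show ?case
    using int_span_add[of "\<Sum>i<n. f i" "n * B" "f n" B] by (simp add: add.commute)
qed

text \<open>Multiplication by \<open>z\<close> shifts the coordinates and feeds the top one back
  through the relation for \<open>z ^ m\<close>. Each new coordinate is at most
  \<open>B + B * \<bar>c j\<bar>\<close>, and \<open>growth - 1\<close> bounds every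
  \<open>\<bar>c j\<bar>\<close>.\<close>

lemma int_span_mult_generator:
  assumes "x \<in> int_span B"
  shows "z * x \<in> int_span (growth * B)"
proof -
  obtain a where a: "x = (\<Sum>j<m. of_int (a j) * z ^ j)" "\<forall>j<m. \<bar>a j\<bar> \<le> int B"
    using assms unfolding int_span_def by blast
  obtain n where n: "m = Suc n"
    using degree_pos gr0_implies_Suc by blast
  define b where "b j = (case j of 0 \<Rightarrow> 0 | Suc i \<Rightarrow> a i) + a n * c j" for j
  have "z * x = (\<Sum>j<n. of_int (a j) * z ^ Suc j) + of_int (a n) * z ^ m"
    unfolding a(1) n by (simp add: sum_distrib_left algebra_simps)
  also have "(\<Sum>j<n. of_int (a j) * z ^ Suc j)
      = (\<Sum>j<m. of_int (case j of 0 \<Rightarrow> 0 | Suc i \<Rightarrow> a i) * z ^ j)"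
    unfolding n by (subst sum.lessThan_Suc_shift) simp
  also have "of_int (a n) * z ^ m = (\<Sum>j<m. of_int (a n * c j) * z ^ j)"
    unfolding power_degree by (simp add: sum_distrib_left algebra_simps)
  finally have "z * x = (\<Sum>j<m. of_int (b j) * z ^ j)"
    by (simp add: b_def sum.distrib[symmetric] algebra_simps)
  moreover have "\<bar>b j\<bar> \<le> int (growth * B)" if "j < m" for j
  proof -
    have "nat \<bar>c j\<bar> \<le> (\<Sum>j<m. nat \<bar>c j\<bar>)"
      using that by (intro member_le_sum) auto
    then have c: "\<bar>c j\<bar> \<le> int (growth - 1)"
      unfolding growth_def by linarith
    have "\<bar>a n * c j\<bar> \<le> int B * int (growth - 1)"
      unfolding abs_mult using a(2) n c by (intro mult_mono) auto
    moreover have "\<bar>case j of 0 \<Rightarrow> 0 | Suc i \<Rightarrow> a i\<bar> \<le> int B"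
      using a(2) that by (auto split: nat.split)
    ultimately have "\<bar>b j\<bar> \<le> int B + int B * int (growth - 1)"
      unfolding b_def by linarith
    then show ?thesis
      by (simp add: growth_def algebra_simps)
  qed
  ultimately show ?thesis
    unfolding int_span_def by blast
qed

lemma int_span_mult_power: "x \<in> int_span B \<Longrightarrow> z ^ j * x \<in> int_span (growth ^ j * B)"
proof (induction j)
  case (Suc j)
  then show ?case
    using int_span_mult_generator[of "z ^ j * x" "growth ^ j * B"] by (simp add: mult.assoc)
qed simp

text \<open>Serves for products in Z[z] and, with \<open>x = 1\<close>, for reducing combinations of
  any length \<open>d\<close> to \<open>m\<close> coordinates. The factor \<open>growth ^ d\<close>
  covers all \<open>z ^ j\<close> with \<open>j < d\<close> at once.\<close>

lemma int_combination_in_int_span: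
  assumes "x \<in> int_span B" "\<And>j. j < d \<Longrightarrow> \<bar>e j\<bar> \<le> int T"
  shows "(\<Sum>j<d. of_int (e j) * z ^ j) * x \<in> int_span (d * (T * (growth ^ d * B)))"
proof -
  have "(\<Sum>j<d. of_int (e j) * (z ^ j * x)) \<in> int_span (d * (T * (growth ^ d * B)))"
  proof (intro int_span_sum int_span_scale assms)
    fix j assume "j < d"
    then have "growth ^ j * B \<le> growth ^ d * B"
      by (intro mult_right_mono power_increasing) (auto simp: growth_def)
    then show "z ^ j * x \<in> int_span (growth ^ d * B)"
      using int_span_mult_power[OF assms(1)] int_span_mono by blast
  qed
  then show ?thesis
    by (simp add: sum_distrib_right mult.assoc)
qed

lemma int_span_power:
  assumes "x \<in> int_span B"
  shows "x ^ i \<in> int_span ((m * growth ^ m * B) ^ i)"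
proof (induction i)
  case 0
  then show ?case using one_in_int_span by simp
next
  case (Suc i)
  obtain a where a: "x = (\<Sum>j<m. of_int (a j) * z ^ j)" "\<forall>j<m. \<bar>a j\<bar> \<le> int B"
    using assms unfolding int_span_def by blast
  have "x * x ^ i \<in> int_span (m * (B * (growth ^ m * (m * growth ^ m * B) ^ i)))"
    using int_combination_in_int_span[OF Suc, of m a B] a by simp
  then show ?case
    by (simp add: mult_ac)
qed

lemma card_int_span: "finite (int_span B)" "card (int_span B) \<le> (2 * B + 1) ^ m"
proof -
  define P where "P = PiE {..<m} (\<lambda>_. {- int B..int B})"
  have fin: "finite P"
    unfolding P_def by (intro finite_PiE) auto
  have card: "card P = (2 * B + 1) ^ m"
    unfolding P_def by (subst card_PiE) (auto simp: nat_add_distrib nat_mult_distrib)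
  have "int_span B \<subseteq> (\<lambda>a. \<Sum>j<m. of_int (a j) * z ^ j) ` P"
  proof
    fix x assume "x \<in> int_span B"
    then obtain a where a: "x = (\<Sum>j<m. of_int (a j) * z ^ j)" "\<forall>j<m. \<bar>a j\<bar> \<le> int B"
      unfolding int_span_def by blast
    have "restrict a {..<m} \<in> P"
      using a(2) unfolding P_def by (auto simp: abs_le_iff)
    moreover have "x = (\<Sum>j<m. of_int (restrict a {..<m} j) * z ^ j)"
      unfolding a(1) by (intro sum.cong) auto
    ultimately show "x \<in> (\<lambda>a. \<Sum>j<m. of_int (a j) * z ^ j) ` P"
      by blast
  qed
  then show "finite (int_span B)" "card (int_span B) \<le> (2 * B + 1) ^ m"
    using fin card card_image_le[OF fin] card_mono[of "_ ` P" "int_span B"]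
    by (auto intro: finite_subset order_trans)
qed

text \<open>Siegel's lemma by counting: the integer combinations of \<open>1, x, \<dots>, x ^ m\<close> with
  coefficients in \<open>{0..<T}\<close> outnumber the values that they can take.\<close>

lemma small_int_relation:
  assumes x: "x \<in> int_span B" and B: "B \<ge> 1"
    and R: "R = (m * growth ^ m * B) ^ m" and T: "T = (3 * Suc m * R) ^ m + 1"
  obtains e :: "nat \<Rightarrow> int" where "\<forall>i\<le>m. \<bar>e i\<bar> \<le> int T" "\<exists>i\<le>m. e i \<noteq> 0"
    "(\<Sum>i\<le>m. of_int (e i) * x ^ i) = 0"
proof -
  define P where "P = PiE {..m} (\<lambda>_. {0..<int T})"
  define f where "f e = (\<Sum>i\<le>m. of_int (e i) * x ^ i)" for e :: "nat \<Rightarrow> int"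
  have K: "m * growth ^ m * B \<ge> 1"
    using B degree_pos by (simp add: growth_def)
  have R1: "R \<ge> 1"
    unfolding R using K one_le_power by blast
  have pow: "x ^ i \<in> int_span R" if "i \<le> m" for i
    using int_span_mono[OF int_span_power[OF x]] power_increasing[OF that K] R by blast
  have sub: "f ` P \<subseteq> int_span (Suc m * (T * R))"
  proof (rule image_subsetI)
    fix e assume "e \<in> P"
    then have "0 \<le> e i \<and> e i < int T" if "i < Suc m" for i
      using that unfolding P_def by (force simp: PiE_iff)
    then show "f e \<in> int_span (Suc m * (T * R))"
      unfolding f_def lessThan_Suc_atMost[symmetric]
      by (intro int_span_sum int_span_scale pow) (auto simp: less_imp_le)
  qed
  have "card (f ` P) \<le> (2 * (Suc m * (T * R)) + 1) ^ m"
    using card_mono[OF card_int_span(1) sub] card_int_span(2) order_trans by blast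
  also have "\<dots> \<le> (T * (3 * Suc m * R)) ^ m"
  proof (rule power_mono)
    have "1 \<le> Suc m * (T * R)"
      using R1 T by simp
    then have "2 * (Suc m * (T * R)) + 1 \<le> 3 * (Suc m * (T * R))"
      by linarith
    also have "\<dots> = T * (3 * Suc m * R)"
      by (simp only: mult_ac)
    finally show "2 * (Suc m * (T * R)) + 1 \<le> T * (3 * Suc m * R)" .
  qed simp
  also have "\<dots> = T ^ m * (3 * Suc m * R) ^ m"
    by (rule power_mult_distrib)
  \<comment> \<open>\<open>T\<close> exceeds \<open>(3 * Suc m * R) ^ m\<close> by one, and there
    are \<open>T ^ Suc m\<close> coefficient vectors.\<close>
  also have "\<dots> < T ^ m * T"
    using T by simp
  also have "\<dots> = card P"
    unfolding P_def by (subst card_PiE) auto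
  finally have "\<not> inj_on f P"
    by (rule pigeonhole)
  then obtain a b where ab: "a \<in> P" "b \<in> P" "f a = f b" "a \<noteq> b"
    unfolding inj_on_def by blast
  have rng: "0 \<le> a i" "a i < int T" "0 \<le> b i" "b i < int T" if "i \<le> m" for i
    using ab(1,2) that unfolding P_def by (force simp: PiE_iff)+
  show ?thesis
  proof (rule that)
    show "\<forall>i\<le>m. \<bar>a i - b i\<bar> \<le> int T"
      using rng by force
    show "\<exists>i\<le>m. a i - b i \<noteq> 0"
      using ab(1,2,4) unfolding P_def by (metis PiE_ext atMost_iff right_minus_eq)
    show "(\<Sum>i\<le>m. of_int (a i - b i) * x ^ i) = 0"
      using ab(3) by (simp add: f_def left_diff_distrib sum_subtractf)
  qed
qed

text \<open>Take a small integer relation among the powers of \<open>x\<close> up to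
  \<open>x ^ m\<close> and divide it by the lowest power that occurs. Its constant term, a nonzero
  integer, is up to sign \<open>x\<close> times a sum of at most \<open>m\<close> terms, which has
  modulus at most \<open>m * T\<close> if \<open>cmod x < 1\<close>. The exponent
  \<open>m * m\<close> is the degree of \<open>T\<close> in \<open>B\<close>.\<close>

lemma int_span_lower_bound:
  "\<exists>C>0. \<forall>B\<ge>1. \<forall>x\<in>int_span B. x \<noteq> 0 \<longrightarrow> 1 \<le> cmod x * (C * real B ^ (m * m))"
proof -
  define A where "A = (3 * Suc m * (m * growth ^ m) ^ m) ^ m + 1"
  have "1 \<le> cmod x * (real (m * A) * real B ^ (m * m))"
    if B: "B \<ge> 1" and x: "x \<in> int_span B" "x \<noteq> 0" for B x
  proof -
    define T where "T = (3 * Suc m * (m * growth ^ m * B) ^ m) ^ m + 1"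
    obtain e :: "nat \<Rightarrow> int" where e: "\<forall>i\<le>m. \<bar>e i\<bar> \<le> int T" "\<exists>i\<le>m. e i \<noteq> 0"
      "(\<Sum>i\<le>m. of_int (e i) * x ^ i) = 0"
      using small_int_relation[OF x(1) B refl T_def] by blast
    have T_le: "T \<le> A * B ^ (m * m)"
    proof -
      have "T = (3 * Suc m * (m * growth ^ m) ^ m) ^ m * B ^ (m * m) + 1"
        unfolding T_def by (simp add: power_mult_distrib power_mult mult_ac)
      also have "\<dots> \<le> A * B ^ (m * m)"
        using B by (simp add: A_def algebra_simps)
      finally show ?thesis .
    qed
    have A1: "A \<ge> 1"
      by (simp add: A_def)
    have bound: "1 \<le> cmod x * real (m * T)"
    proof (cases "cmod x \<ge> 1")
      case True
      have "1 \<le> real (m * T)"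
        using degree_pos by (simp add: T_def Suc_le_eq del: of_nat_mult)
      then show ?thesis
        using mult_mono[of 1 "cmod x" 1 "real (m * T)"] True by simp
    next
      case False
      define k where "k = (LEAST i. e i \<noteq> 0)"
      obtain i where i: "i \<le> m" "e i \<noteq> 0" using e(2) by blast
      have k: "e k \<noteq> 0" "k \<le> m"
        unfolding k_def using i LeastI[of "\<lambda>i. e i \<noteq> 0" i] Least_le[of "\<lambda>i. e i \<noteq> 0" i] by simp_all
      have below: "e i = 0" if "i < k" for i
        using that not_less_Least unfolding k_def by blast
      have "(\<Sum>i\<le>m. of_int (e i) * x ^ i) = (\<Sum>i\<in>{k..m}. of_int (e i) * x ^ i)"
        using below by (intro sum.mono_neutral_right) (auto simp: not_le)
      also have "\<dots> = of_int (e k) * x ^ k + (\<Sum>i\<in>{Suc k..m}. of_int (e i) * x ^ i)"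
        using k by (subst sum.atLeast_Suc_atMost) auto
      also have "(\<Sum>i\<in>{Suc k..m}. of_int (e i) * x ^ i)
          = x ^ k * (x * (\<Sum>i\<in>{Suc k..m}. of_int (e i) * x ^ (i - Suc k)))"
        unfolding sum_distrib_left
      proof (rule sum.cong)
        fix i assume "i \<in> {Suc k..m}"
        then have "x ^ i = x ^ (k + (1 + (i - Suc k)))" by simp
        then show "of_int (e i) * x ^ i = x ^ k * (x * (of_int (e i) * x ^ (i - Suc k)))"
          unfolding power_add by simp
      qed simp
      finally have "x ^ k * (of_int (e k) + x * (\<Sum>i\<in>{Suc k..m}. of_int (e i) * x ^ (i - Suc k))) = 0"
        using e(3) by (simp add: algebra_simps)
      then have "of_int (e k) = - (x * (\<Sum>i\<in>{Suc k..m}. of_int (e i) * x ^ (i - Suc k)))"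
        using x(2) by (simp add: eq_neg_iff_add_eq_0)
      then have "cmod (of_int (e k)) = cmod x * cmod (\<Sum>i\<in>{Suc k..m}. of_int (e i) * x ^ (i - Suc k))"
        by (simp add: norm_mult)
      moreover have "cmod (\<Sum>i\<in>{Suc k..m}. of_int (e i) * x ^ (i - Suc k)) \<le> real (m * T)"
      proof -
        have "cmod (\<Sum>i\<in>{Suc k..m}. of_int (e i) * x ^ (i - Suc k)) \<le> (\<Sum>i\<in>{Suc k..m}. real T)"
        proof (rule sum_norm_le)
          fix i assume "i \<in> {Suc k..m}"
          then have "\<bar>real_of_int (e i)\<bar> \<le> real T"
            using e(1) by (metis atLeastAtMost_iff of_int_abs of_int_le_iff of_int_of_nat_eq)
          moreover have "cmod x ^ (i - Suc k) \<le> 1"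
            using False by (intro power_le_one) auto
          ultimately show "cmod (of_int (e i) * x ^ (i - Suc k)) \<le> real T"
            using mult_mono[of "\<bar>real_of_int (e i)\<bar>" "real T" "cmod x ^ (i - Suc k)" 1]
            by (simp add: norm_mult norm_power)
        qed
        also have "\<dots> \<le> real (m * T)"
          by (auto intro!: mult_right_mono)
        finally show ?thesis .
      qed
      moreover have "1 \<le> cmod (of_int (e k))"
        using k(1) by (simp flip: of_int_abs)
      ultimately show ?thesis
        by (metis mult_left_mono norm_ge_zero order_trans)
    qed
    have "real (m * T) \<le> real (m * (A * B ^ (m * m)))"
      using T_le by (intro of_nat_mono mult_left_mono) auto
    then have "cmod x * real (m * T) \<le> cmod x * (real (m * A) * real B ^ (m * m))"
      by (intro mult_left_mono) (auto simp: mult_ac)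
    then show ?thesis using bound by linarith
  qed
  moreover have "real (m * A) > 0"
    using degree_pos by (simp add: A_def add_pos_nonneg)
  ultimately show ?thesis by blast
qed

end

lemma algebraic_int_imp_integral_element:
  fixes z :: complex
  assumes "algebraic_int z"
  obtains m c where "integral_element z m c"
proof -
  obtain p where p: "lead_coeff p = 1" "poly (map_poly of_int p) z = 0"
    using assms by (auto simp: algebraic_int_altdef_ipoly)
  define m where "m = degree p"
  have deg: "degree (map_poly of_int p :: complex poly) = m"
    unfolding m_def by (intro degree_map_poly) auto
  have "(\<Sum>j<m. of_int (coeff p j) * z ^ j) + z ^ m = 0"
    using p unfolding poly_altdef deg
    by (simp add: coeff_map_poly lessThan_Suc_atMost[symmetric] m_def)
  then have eq: "z ^ m = (\<Sum>j<m. of_int (- coeff p j) * z ^ j)"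
    by (simp add: sum_negf eq_neg_iff_add_eq_0 add.commute)
  moreover have "m > 0"
    using eq by (cases m) auto
  ultimately have "integral_element z m (\<lambda>j. - coeff p j)"
    by unfold_locales
  then show ?thesis by (rule that)
qed

text \<open>Reduction to \<open>m\<close> coordinates enlarges the height only by the constant
  factor \<open>L\<close>, so the bound on \<open>int_span\<close> carries over, with
  \<open>C\<close> and \<open>D\<close> depending on \<open>z\<close> and \<open>d\<close>
  alone.\<close>

lemma algebraic_int_combination_lower_bound:
  fixes z :: complex
  assumes "algebraic_int z"
  shows "\<exists>C>0. \<exists>D. \<forall>B\<ge>1. \<forall>e::nat \<Rightarrow> int. (\<forall>j<d. \<bar>e j\<bar> \<le> int B) \<longrightarrow>
      (\<Sum>j<d. of_int (e j) * z ^ j) \<noteq> 0 \<longrightarrow>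
      1 \<le> cmod (\<Sum>j<d. of_int (e j) * z ^ j) * (C * real B ^ D)"
proof (cases "d = 0")
  case True
  then show ?thesis by (auto intro: exI[of _ 1])
next
  case False
  obtain m c where "integral_element z m c"
    using algebraic_int_imp_integral_element[OF assms] .
  then interpret integral_element z m c .
  obtain C where C: "C > 0"
    "\<And>B x. B \<ge> 1 \<Longrightarrow> x \<in> int_span B \<Longrightarrow> x \<noteq> 0 \<Longrightarrow> 1 \<le> cmod x * (C * real B ^ (m * m))"
    using int_span_lower_bound by blast
  define L where "L = d * growth ^ d"
  have L: "L \<ge> 1"
    using False by (simp add: L_def growth_def)
  have "1 \<le> cmod (\<Sum>j<d. of_int (e j) * z ^ j) * (C * real L ^ (m * m) * real B ^ (m * m))"
    if "B \<ge> 1" "\<forall>j<d. \<bar>e j\<bar> \<le> int B" "(\<Sum>j<d. of_int (e j) * z ^ j) \<noteq> 0" for B e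
  proof -
    have "(\<Sum>j<d. of_int (e j) * z ^ j) \<in> int_span (L * B)"
      using int_combination_in_int_span[OF one_in_int_span, of d e B] that(2)
      by (simp add: L_def mult_ac)
    then show ?thesis
      using C(2)[of "L * B"] that(1,3) L by (simp add: power_mult_distrib mult.assoc)
  qed
  moreover have "C * real L ^ (m * m) > 0"
    using C(1) L by simp
  ultimately show ?thesis by blast
qed

section \<open>Galois conjugates\<close>

lemma poly_of_rat_add:
  fixes x :: complex
  shows "poly (map_poly of_rat (p + q)) x = poly (map_poly of_rat p) x + poly (map_poly of_rat q) x"
proof -
  have "map_poly of_rat (p + q) = map_poly of_rat p + (map_poly of_rat q :: complex poly)"
    by (intro poly_eqI) (simp add: coeff_map_poly of_rat_add)
  then show ?thesis by simp
qed

lemma poly_of_rat_mult: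
  fixes x :: complex
  shows "poly (map_poly of_rat (p * q)) x = poly (map_poly of_rat p) x * poly (map_poly of_rat q) x"
proof (induction p)
  case (pCons a p)
  have "poly (map_poly of_rat (smult a q)) x = of_rat a * poly (map_poly of_rat q) x"
  proof -
    have "map_poly of_rat (smult a q) = smult (of_rat a) (map_poly of_rat q :: complex poly)"
      by (intro poly_eqI) (simp add: coeff_map_poly of_rat_mult)
    then show ?thesis by simp
  qed
  then show ?case
    using pCons.IH by (simp add: poly_of_rat_add map_poly_pCons algebra_simps)
qed simp

text \<open>Otherwise \<open>q\<close> and \<open>r\<close> are coprime, and evaluating a Bezout
  identity \<open>u * q + v * r = 1\<close> at \<open>x\<close> gives \<open>0 = 1\<close>.\<close>

lemma irreducible_dvd_of_common_root:
  fixes x :: complex and q r :: "rat poly"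
  assumes "irreducible q" "poly (map_poly of_rat q) x = 0" "poly (map_poly of_rat r) x = 0"
  shows "q dvd r"
proof (rule ccontr)
  assume "\<not> q dvd r"
  have "prime_elem q"
    using assms(1) by (rule field_poly_irreducible_imp_prime)
  then have "coprime q r"
    using \<open>\<not> q dvd r\<close> by (rule prime_elem_imp_coprime)
  then obtain u v where "u * q + v * r = 1"
    using bezout_coefficients_fst_snd[of q r] unfolding coprime_iff_gcd_eq_1 by metis
  then have "poly (map_poly of_rat (u * q + v * r)) x = 1"
    by (simp add: map_poly_1)
  then show False
    using assms(2,3) by (simp add: poly_of_rat_add poly_of_rat_mult)
qed

lemma rat_poly_common_denominator:
  fixes q :: "rat poly"
  shows "\<exists>t::int. t \<noteq> 0 \<and> (\<forall>i. of_int t * coeff q i \<in> \<int>)"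
proof (induction q)
  case 0
  then show ?case by (intro exI[of _ 1]) auto
next
  case (pCons a q)
  then obtain t :: int where t: "t \<noteq> 0" "\<And>i. of_int t * coeff q i \<in> \<int>" by blast
  obtain u v where quot: "quotient_of a = (u, v)"
    by (cases "quotient_of a")
  have uv: "a = of_int u / of_int v" "v \<noteq> 0"
    using quotient_of_div[OF quot] quotient_of_denom_pos[OF quot] by auto
  have "of_int (t * v) * coeff (pCons a q) i \<in> \<int>" for i
  proof (cases i)
    case 0
    have "of_int (t * v) * a = of_int (t * u)"
      using uv by simp
    then show ?thesis
      using 0 by (metis Ints_of_int coeff_pCons_0)
  next
    case (Suc j)
    have "of_int (t * v) * coeff q j = of_int v * (of_int t * coeff q j)" by simp
    then show ?thesis
      using Suc t(2) by (metis Ints_mult Ints_of_int coeff_pCons_Suc)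
  qed
  then show ?case
    using t(1) uv(2) by (intro exI[of _ "t * v"]) auto
qed

lemma poly_of_rat_int_sum:
  fixes x :: complex and a :: "nat \<Rightarrow> int"
  assumes "\<And>i. of_int t * coeff q i = of_int (a i)" "degree q \<le> n"
  shows "of_int t * poly (map_poly of_rat q) x = (\<Sum>i\<le>n. of_int (a i) * x ^ i)"
proof -
  have "poly (map_poly of_rat q) x = (\<Sum>i\<le>n. of_rat (coeff q i) * x ^ i)"
  proof -
    have "(\<Sum>i\<le>degree q. of_rat (coeff q i) * x ^ i) = (\<Sum>i\<le>n. of_rat (coeff q i) * x ^ i)"
      using assms(2) by (intro sum.mono_neutral_left) (auto simp: coeff_eq_0)
    then show ?thesis
      by (simp add: poly_altdef coeff_map_poly degree_map_poly)
  qed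
  moreover have "of_int t * of_rat (coeff q i) = (of_int (a i) :: complex)" for i
    using arg_cong[OF assms(1), of "of_rat :: rat \<Rightarrow> complex" i] by (simp add: of_rat_mult)
  ultimately show ?thesis
    by (simp add: sum_distrib_left flip: mult.assoc)
qed

text \<open>Clearing denominators in the common irreducible polynomial gives \<open>a\<close>. The
  last conclusion is linear independence of the powers of \<open>z\<close> below \<open>d\<close>: a
  vanishing combination would be a nonzero polynomial of degree less than \<open>d\<close> divisible
  by the irreducible one.\<close>

lemma galois_conjugate_int_relation:
  assumes "galois_conjugate x z"
  obtains a :: "nat \<Rightarrow> int" and d where "d > 0" "a d \<noteq> 0" "\<forall>i>d. a i = 0"
    "(\<Sum>i\<le>d. of_int (a i) * x ^ i) = 0" "(\<Sum>i\<le>d. of_int (a i) * z ^ i) = 0"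
    "\<And>e j. j < d \<Longrightarrow> e j \<noteq> 0 \<Longrightarrow> (\<Sum>j<d. of_int (e j :: int) * z ^ j) \<noteq> 0"
proof -
  obtain q :: "rat poly" where q: "irreducible q"
    "poly (map_poly of_rat q) x = 0" "poly (map_poly of_rat q) z = 0"
    using assms unfolding galois_conjugate_def by blast
  obtain t :: int where t: "t \<noteq> 0" "\<And>i. of_int t * coeff q i \<in> \<int>"
    using rat_poly_common_denominator by blast
  have "\<forall>i. \<exists>n::int. of_int t * coeff q i = of_int n"
    using t(2) Ints_cases by metis
  then obtain a :: "nat \<Rightarrow> int" where a: "\<And>i. of_int t * coeff q i = of_int (a i)"
    by metis
  define d where "d = degree q"
  have q0: "q \<noteq> 0" using q(1) by auto
  have "a d \<noteq> 0"
    using a[of d] t(1) q0 unfolding d_def by auto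
  moreover have "d > 0"
    using q(1) q0 unfolding d_def
    by (metis irreducible_not_unit is_unit_iff_degree neq0_conv)
  moreover have "a i = 0" if "i > d" for i
    using a[of i] that coeff_eq_0[of q i] unfolding d_def by simp
  moreover have "(\<Sum>i\<le>d. of_int (a i) * x ^ i) = 0" "(\<Sum>i\<le>d. of_int (a i) * z ^ i) = 0"
    using poly_of_rat_int_sum[OF a order.refl, of x] poly_of_rat_int_sum[OF a order.refl, of z] q
    by (auto simp: d_def)
  moreover have "(\<Sum>j<d. of_int (e j) * z ^ j) \<noteq> 0" if "j < d" "e j \<noteq> 0" for e :: "nat \<Rightarrow> int" and j
  proof
    assume sum: "(\<Sum>j<d. of_int (e j) * z ^ j) = 0"
    define e' where "e' i = (if i < d then e i else 0)" for i
    define r :: "rat poly" where "r = Poly (map (\<lambda>i. of_int (e' i)) [0..<d])"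
    have coeff_r: "coeff r i = of_int (e' i)" for i
      by (auto simp: r_def e'_def nth_default_def)
    have "degree r \<le> d - 1"
      by (rule degree_le) (auto simp: coeff_r e'_def)
    then have deg: "degree r < d"
      using \<open>d > 0\<close> by linarith
    have "poly (map_poly of_rat r) z = (\<Sum>i\<le>d. of_int (e' i) * z ^ i)"
      using poly_of_rat_int_sum[of 1 r e' d z] coeff_r deg by simp
    also have "\<dots> = (\<Sum>j<d. of_int (e j) * z ^ j)"
      unfolding lessThan_Suc_atMost[symmetric] by (simp add: e'_def)
    finally have "q dvd r"
      using sum q irreducible_dvd_of_common_root by simp
    moreover have "r \<noteq> 0"
      using that coeff_r[of j] by (auto simp: e'_def)
    ultimately show False
      using deg dvd_imp_degree_le[of q r] unfolding d_def by simp
  qed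
  ultimately show ?thesis
    using that[of d a] by blast
qed

text \<open>The common irreducible polynomial divides every monic integer polynomial vanishing at
  \<open>x\<close>, so such a polynomial vanishes at \<open>z\<close> too.\<close>

lemma galois_conjugate_algebraic_int:
  assumes "galois_conjugate x z" "algebraic_int x"
  shows "algebraic_int z"
proof -
  obtain q :: "rat poly" where q: "irreducible q"
    "poly (map_poly of_rat q) x = 0" "poly (map_poly of_rat q) z = 0"
    using assms(1) unfolding galois_conjugate_def by blast
  obtain p where p: "lead_coeff p = 1" "poly (map_poly of_int p) x = 0"
    using assms(2) by (auto simp: algebraic_int_altdef_ipoly)
  have eq: "map_poly of_rat (map_poly of_int p :: rat poly) = (map_poly of_int p :: complex poly)"
    by (intro poly_eqI) (simp add: coeff_map_poly)
  have "q dvd map_poly of_int p"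
    using irreducible_dvd_of_common_root[OF q(1,2)] p(2) by (simp add: eq)
  then obtain s where "map_poly of_int p = q * s" by (rule dvdE)
  then have "poly (map_poly of_int p) z = 0"
    using q(3) poly_of_rat_mult[of q s z] by (simp flip: eq)
  then show ?thesis
    using p(1) by (auto simp: algebraic_int_altdef_ipoly)
qed

section \<open>Powers far from the integers\<close>

text \<open>If \<open>z\<close> is a root of \<open>q(X) = \<Sum>i\<le>d. a i * X ^ i\<close>, these are the coefficients of
  \<open>q(X) / (X - z)\<close>. The functional that they define is an eigenvector, with eigenvalue \<open>z\<close>,
  of the shift on solutions of the linear recurrence given by \<open>a\<close>.\<close>

definition quotient_coeff :: "(nat \<Rightarrow> int) \<Rightarrow> nat \<Rightarrow> complex \<Rightarrow> nat \<Rightarrow> complex" where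
  "quotient_coeff a d z j = (\<Sum>m<d. of_int (a (m + j + 1)) * z ^ m)"

text \<open>Comparing coefficients in \<open>q(X) = (X - z) * (\<Sum>j<d. b j * X ^ j)\<close> gives
  \<open>b j = a (Suc j) + z * b (Suc j)\<close> and \<open>a 0 + z * b 0 = 0\<close>; summation by
  shifting does the rest. The last summand measures the failure of \<open>u\<close> to satisfy the
  recurrence.\<close>

lemma quotient_coeff_shift:
  assumes supp: "\<forall>i>d. a i = 0" and root: "(\<Sum>i\<le>d. of_int (a i) * z ^ i) = 0"
  shows "(\<Sum>j<d. quotient_coeff a d z j * u (Suc j))
    = z * (\<Sum>j<d. quotient_coeff a d z j * u j) + (\<Sum>j\<le>d. of_int (a j) * u j)"
proof -
  let ?b = "quotient_coeff a d z"
  have b_step: "?b j = of_int (a (Suc j)) + z * ?b (Suc j)" for j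
  proof -
    define f where "f m = of_int (a (m + j + 1)) * z ^ m" for m
    have "?b j = (\<Sum>m<Suc d. f m)"
      using supp by (simp add: quotient_coeff_def f_def)
    also have "\<dots> = f 0 + (\<Sum>m<d. f (Suc m))"
      by (rule sum.lessThan_Suc_shift)
    also have "(\<Sum>m<d. f (Suc m)) = z * ?b (Suc j)"
      by (simp add: quotient_coeff_def f_def sum_distrib_left mult_ac)
    finally show ?thesis
      by (simp add: f_def)
  qed
  have b_0: "of_int (a 0) + z * ?b 0 = 0"
  proof -
    have "(\<Sum>i\<le>d. of_int (a i) * z ^ i) = of_int (a 0) + (\<Sum>m<d. of_int (a (Suc m)) * z ^ Suc m)"
      unfolding lessThan_Suc_atMost[symmetric] by (subst sum.lessThan_Suc_shift) simp
    also have "(\<Sum>m<d. of_int (a (Suc m)) * z ^ Suc m) = z * ?b 0"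
      by (simp add: quotient_coeff_def sum_distrib_left mult_ac)
    finally show ?thesis
      using root by simp
  qed
  have b_d: "?b d = 0"
    using supp by (simp add: quotient_coeff_def)
  have "(\<Sum>j<d. ?b j * u (Suc j)) = (\<Sum>j<d. of_int (a (Suc j)) * u (Suc j) + z * (?b (Suc j) * u (Suc j)))"
    by (intro sum.cong refl) (subst b_step, simp add: algebra_simps)
  also have "\<dots> = (\<Sum>j<d. of_int (a (Suc j)) * u (Suc j)) + z * (\<Sum>j<d. ?b (Suc j) * u (Suc j))"
    by (simp add: sum.distrib sum_distrib_left)
  also have "(\<Sum>j<d. of_int (a (Suc j)) * u (Suc j)) = (\<Sum>j\<le>d. of_int (a j) * u j) - of_int (a 0) * u 0"
    unfolding lessThan_Suc_atMost[symmetric] by (subst sum.lessThan_Suc_shift) simp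
  also have "(\<Sum>j<d. ?b (Suc j) * u (Suc j)) = (\<Sum>j<d. ?b j * u j) - ?b 0 * u 0"
    using sum.lessThan_Suc_shift[of "\<lambda>j. ?b j * u j" d] b_d by simp
  also have "(\<Sum>j\<le>d. of_int (a j) * u j) - of_int (a 0) * u 0 + z * ((\<Sum>j<d. ?b j * u j) - ?b 0 * u 0)
      = z * (\<Sum>j<d. ?b j * u j) + (\<Sum>j\<le>d. of_int (a j) * u j) - (of_int (a 0) + z * ?b 0) * u 0"
    by (simp add: algebra_simps)
  finally show ?thesis
    using b_0 by simp
qed

lemma powers_far_from_integers:
  fixes \<theta> :: real and z :: complex
  assumes \<theta>: "\<theta> > 1" "algebraic_int (of_real \<theta> :: complex)"
    and conj: "galois_conjugate (of_real \<theta>) z" and z: "z \<noteq> of_real \<theta>" "cmod z > 1"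
  shows "\<exists>\<delta>>0. \<exists>M. \<forall>y\<in>{1..\<theta>}. \<forall>k\<ge>1. \<exists>n\<in>{k..M * k}. \<delta> \<le> \<bar>\<theta> ^ n * y - of_int (round (\<theta> ^ n * y))\<bar>"
proof -
  obtain a :: "nat \<Rightarrow> int" and d where d: "d > 0" and ad: "a d \<noteq> 0" and supp: "\<forall>i>d. a i = 0"
    and root_\<theta>: "(\<Sum>i\<le>d. of_int (a i) * complex_of_real \<theta> ^ i) = 0"
    and root_z: "(\<Sum>i\<le>d. of_int (a i) * z ^ i) = 0"
    and indep: "\<And>e j. j < d \<Longrightarrow> e j \<noteq> 0 \<Longrightarrow> (\<Sum>j<d. of_int (e j :: int) * z ^ j) \<noteq> 0"
    by (rule galois_conjugate_int_relation[OF conj]) blast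
  have "algebraic_int z"
    using conj \<theta>(2) by (rule galois_conjugate_algebraic_int)
  from algebraic_int_combination_lower_bound[OF this, of d]
  obtain C D where C: "C > 0" and liouville: "\<forall>B\<ge>1. \<forall>e. (\<forall>j<d. \<bar>e j\<bar> \<le> int B) \<longrightarrow>
      (\<Sum>j<d. of_int (e j) * z ^ j) \<noteq> 0 \<longrightarrow>
      1 \<le> cmod (\<Sum>j<d. of_int (e j) * z ^ j) * (C * real B ^ D)"
    by (elim exE conjE)
  let ?b = "quotient_coeff a d z"
  define A where "A = (\<Sum>i\<le>d. nat \<bar>a i\<bar>)"
  have a_le: "\<bar>a i\<bar> \<le> int A" for i
  proof (cases "i \<le> d")
    case True
    then have "nat \<bar>a i\<bar> \<le> A"
      unfolding A_def by (intro member_le_sum) auto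
    then show ?thesis by linarith
  qed (use supp in simp)
  have A: "A \<ge> 1"
    using a_le[of d] ad by linarith
  define S where "S = (\<Sum>j<d. cmod (?b j))"
  have S: "S \<ge> 0"
    unfolding S_def by (intro sum_nonneg) auto
  \<comment> \<open>Small enough that an integer combination of errors below \<open>\<delta>\<close>
    with coefficients \<open>a\<close> stays below 1 in absolute value.\<close>
  define \<delta> where "\<delta> = 1 / (2 * real (A + 1))"
  have \<delta>: "\<delta> > 0" "\<delta> < 1 / 2" "\<delta> * real A < 1 / 2"
    using A by (auto simp: \<delta>_def field_simps)
  \<comment> \<open>What remains of the upper bound in the final chain once
    \<open>(\<theta> ^ D) ^ k\<close> is split off.\<close>
  define E where "E = C * (real (d * A) * (4 * \<theta> ^ Suc d)) ^ D * S"
  have E: "E \<ge> 0"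
    using C S \<theta> by (simp add: E_def)
  \<comment> \<open>After \<open>M0 * k\<close> shifts the growth of \<open>cmod z\<close> beats the
    Liouville loss \<open>(\<theta> ^ D) ^ k\<close>. With \<open>E + 1\<close> in place of
    \<open>E\<close>, the constant can be raised to the power \<open>k\<close>.\<close>
  obtain M0 where M0: "(E + 1) * \<theta> ^ D < cmod z ^ M0"
    using real_arch_pow[OF z(2)] by blast
  \<comment> \<open>Leaves room in the block for \<open>M0 * k\<close> shifts and for the
    \<open>d\<close> consecutive terms that \<open>F\<close> reads.\<close>
  define M where "M = M0 + d + 1"
  have "\<exists>n\<in>{k..M * k}. \<delta> \<le> \<bar>\<theta> ^ n * y - of_int (round (\<theta> ^ n * y))\<bar>"
    if y: "1 \<le> y" "y \<le> \<theta>" and k: "k \<ge> 1" for y k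
  proof (rule ccontr)
    define K where "K n = round (\<theta> ^ n * y)" for n
    define \<epsilon> where "\<epsilon> n = \<theta> ^ n * y - of_int (K n)" for n
    define F where "F n = (\<Sum>j<d. ?b j * of_int (K (n + j)))" for n
    define s where "s = M0 * k"
    assume "\<not> ?thesis"
    then have small: "\<bar>\<epsilon> n\<bar> < \<delta>" if "n \<in> {k..M * k}" for n
      using that by (force simp: \<epsilon>_def K_def)
    have last: "k + s + d - 1 \<le> M * k"
    proof -
      have "d \<le> d * k" using k by simp
      moreover have "M * k = M0 * k + d * k + k"
        by (simp add: M_def algebra_simps)
      ultimately show ?thesis unfolding s_def by linarith
    qed
    \<comment> \<open>The sequence \<open>\<theta> ^ n * y\<close> satisfies the recurrence exactly,
      so the integer on the left is minus a combination of rounding errors and has absolute value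
      less than 1.\<close>
    have rec: "(\<Sum>j\<le>d. a j * K (n + j)) = 0" if n: "k \<le> n" "n + d \<le> M * k" for n
    proof -
      have "(\<Sum>j\<le>d. of_int (a j) * \<theta> ^ (n + j) * y) = \<theta> ^ n * y * (\<Sum>j\<le>d. of_int (a j) * \<theta> ^ j)"
        by (simp add: power_add sum_distrib_left mult_ac)
      also have "complex_of_real (\<Sum>j\<le>d. of_int (a j) * \<theta> ^ j) = 0"
        using root_\<theta> by simp
      then have "(\<Sum>j\<le>d. of_int (a j) * \<theta> ^ j) = 0"
        using of_real_eq_0_iff by blast
      finally have "of_int (\<Sum>j\<le>d. a j * K (n + j)) = - (\<Sum>j\<le>d. of_int (a j) * \<epsilon> (n + j))"
        by (simp add: \<epsilon>_def algebra_simps sum_subtractf)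
      also have "\<bar>\<dots>\<bar> \<le> (\<Sum>j\<le>d. real (nat \<bar>a j\<bar>) * \<delta>)"
        unfolding abs_minus_cancel
      proof (rule sum_norm_le[where 'a = real, unfolded real_norm_def])
        fix j assume "j \<in> {..d}"
        then have "\<bar>\<epsilon> (n + j)\<bar> \<le> \<delta>"
          using n small[of "n + j"] by simp
        then show "\<bar>of_int (a j) * \<epsilon> (n + j)\<bar> \<le> real (nat \<bar>a j\<bar>) * \<delta>"
          by (simp add: abs_mult mult_left_mono)
      qed
      also have "\<dots> = \<delta> * real A"
        by (simp add: A_def sum_distrib_left mult_ac)
      finally have "\<bar>real_of_int (\<Sum>j\<le>d. a j * K (n + j))\<bar> < 1"
        using \<delta>(3) by linarith
      then show ?thesis by linarith
    qed
    have F_Suc: "F (Suc n) = z * F n" if "k \<le> n" "n + d \<le> M * k" for n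
    proof -
      have "(\<Sum>j\<le>d. of_int (a j) * of_int (K (n + j)) :: complex) = of_int (\<Sum>j\<le>d. a j * K (n + j))"
        by simp
      then show ?thesis
        using quotient_coeff_shift[OF supp root_z, of "\<lambda>j. of_int (K (n + j))"] rec[OF that]
        unfolding F_def by simp
    qed
    have F_power: "k + t + d - 1 \<le> M * k \<Longrightarrow> F (k + t) = z ^ t * F k" for t
    proof (induction t)
      case (Suc t)
      then show ?case
        using F_Suc[of "k + t"] d by simp
    qed simp
    have F_le: "cmod (F (k + s)) \<le> S"
    proof -
      \<comment> \<open>The shift multiplies the functional on the powers of \<open>\<theta>\<close>
        both by \<open>z\<close> and by \<open>\<theta>\<close>. As these differ, its value is zero,
        and \<open>F\<close> sees only the errors \<open>\<epsilon>\<close>.\<close>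
      have "(\<Sum>j<d. ?b j * complex_of_real \<theta> ^ Suc j) = z * (\<Sum>j<d. ?b j * complex_of_real \<theta> ^ j)"
        using quotient_coeff_shift[OF supp root_z, of "\<lambda>j. complex_of_real \<theta> ^ j"] root_\<theta> by simp
      then have "(complex_of_real \<theta> - z) * (\<Sum>j<d. ?b j * complex_of_real \<theta> ^ j) = 0"
        by (simp add: sum_distrib_left sum_subtractf algebra_simps)
      then have zero: "(\<Sum>j<d. ?b j * complex_of_real \<theta> ^ j) = 0"
        using z(1) by simp
      have "F (k + s) = (\<Sum>j<d. of_real (\<theta> ^ (k + s) * y) * (?b j * complex_of_real \<theta> ^ j) - ?b j * of_real (\<epsilon> (k + s + j)))"
        unfolding F_def \<epsilon>_def by (intro sum.cong) (simp_all add: power_add algebra_simps)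
      also have "\<dots> = - (\<Sum>j<d. ?b j * of_real (\<epsilon> (k + s + j)))"
        unfolding sum_subtractf sum_distrib_left[symmetric] zero by simp
      finally have "cmod (F (k + s)) = cmod (\<Sum>j<d. ?b j * of_real (\<epsilon> (k + s + j)))"
        by simp
      also have "\<dots> \<le> S"
        unfolding S_def
      proof (rule sum_norm_le)
        fix j assume "j \<in> {..<d}"
        then have "k + s + j \<in> {k..M * k}"
          using last by (simp add: less_eq_Suc_le)
        from small[OF this] have "\<bar>\<epsilon> (k + s + j)\<bar> \<le> 1"
          using \<delta>(2) by linarith
        then show "cmod (?b j * of_real (\<epsilon> (k + s + j))) \<le> cmod (?b j)"
          by (simp add: norm_mult mult_left_le)
      qed
      finally show ?thesis .
    qed
    define e where "e i = (\<Sum>j<d. a (i + j + 1) * K (k + j))" for i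
    have F_e: "F k = (\<Sum>i<d. of_int (e i) * z ^ i)"
    proof -
      have "F k = (\<Sum>j<d. \<Sum>i<d. of_int (a (i + j + 1)) * of_int (K (k + j)) * z ^ i)"
        unfolding F_def quotient_coeff_def by (simp add: sum_distrib_right sum_distrib_left mult_ac)
      also have "\<dots> = (\<Sum>i<d. of_int (e i) * z ^ i)"
        unfolding e_def by (subst sum.swap) (simp add: sum_distrib_right)
      finally show ?thesis .
    qed
    \<comment> \<open>Only \<open>j = 0\<close> contributes, since \<open>a\<close> vanishes above
      \<open>d\<close>. Because \<open>\<theta> ^ k * y\<close> is at least 1, \<open>K k\<close> is
      nonzero, and independence of the powers of \<open>z\<close> gives
      \<open>F k \<noteq> 0\<close>.\<close>
    have "e (d - 1) = a d * K k"
    proof -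
      have "e (d - 1) = (\<Sum>j<d. if j = 0 then a d * K k else 0)"
        unfolding e_def using d supp by (intro sum.cong) auto
      then show ?thesis using d by simp
    qed
    moreover have "K k \<noteq> 0"
    proof -
      have "1 * 1 \<le> \<theta> ^ k * y"
        using \<theta> y by (intro mult_mono) auto
      then show ?thesis
        unfolding K_def using of_int_round_abs_le[of "\<theta> ^ k * y"] by fastforce
    qed
    ultimately have F_nz: "F k \<noteq> 0"
      unfolding F_e using indep[of "d - 1" e] d ad by simp
    \<comment> \<open>An integer bound for the \<open>K (k + j)\<close>: the factor 2 absorbs the
      rounding error, and the ceiling still stays below
      \<open>4 * \<theta> ^ (k + Suc d)\<close>.\<close>
    define X where "X = nat \<lceil>2 * \<theta> ^ (k + Suc d)\<rceil>"
    have \<theta>1: "1 \<le> \<theta> ^ (k + Suc d)"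
      using \<theta> by (intro one_le_power) simp
    have X: "X \<ge> 1" "real X \<le> 4 * \<theta> ^ (k + Suc d)" "2 * \<theta> ^ (k + Suc d) \<le> real X"
      using \<theta>1 unfolding X_def by linarith+
    have K_le: "\<bar>K (k + j)\<bar> \<le> int X" if "j < d" for j
    proof -
      have "\<theta> ^ (k + j) * y \<le> \<theta> ^ (k + d) * \<theta>"
        using \<theta> y that by (intro mult_mono power_increasing) auto
      moreover have "0 \<le> \<theta> ^ (k + j) * y"
        using \<theta> y by simp
      moreover have "\<bar>real_of_int (K (k + j)) - \<theta> ^ (k + j) * y\<bar> \<le> 1 / 2"
        unfolding K_def by (rule of_int_round_abs_le)
      moreover have "\<theta> ^ (k + d) * \<theta> = \<theta> ^ (k + Suc d)"
        by simp
      ultimately have "\<bar>real_of_int (K (k + j))\<bar> \<le> \<theta> ^ (k + Suc d) + 1 / 2"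
        by linarith
      then have "\<bar>real_of_int (K (k + j))\<bar> \<le> real X"
        using X(3) \<theta>1 by linarith
      then show ?thesis by linarith
    qed
    have "\<bar>e i\<bar> \<le> int (d * A * X)" for i
    proof -
      have "\<bar>e i\<bar> \<le> (\<Sum>j<d. \<bar>a (i + j + 1) * K (k + j)\<bar>)"
        unfolding e_def by (rule sum_abs)
      also have "\<dots> \<le> (\<Sum>j<d. int A * int X)"
        unfolding abs_mult by (intro sum_mono mult_mono a_le K_le) auto
      finally show ?thesis by simp
    qed
    moreover have "d * A * X \<ge> 1"
      using d A X(1) by simp
    ultimately have "1 \<le> cmod (F k) * (C * real (d * A * X) ^ D)"
      using liouville[rule_format, of "d * A * X" e] F_nz unfolding F_e by blast
    also have "\<dots> \<le> cmod (F k) * (C * (real (d * A) * (4 * \<theta> ^ (k + Suc d))) ^ D)"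
      using X(2) C by (intro mult_left_mono power_mono) (auto intro: mult_left_mono)
    \<comment> \<open>The factor \<open>cmod z ^ s\<close> turns the Liouville bound for
      \<open>F k\<close> into one for \<open>F (k + s)\<close>, which is at most
      \<open>S\<close>.\<close>
    finally have "cmod z ^ s * 1 \<le> cmod z ^ s * (cmod (F k) * (C * (real (d * A) * (4 * \<theta> ^ (k + Suc d))) ^ D))"
      by (intro mult_left_mono) auto
    also have "\<dots> = cmod (F (k + s)) * (C * (real (d * A) * (4 * \<theta> ^ (k + Suc d))) ^ D)"
      using F_power[OF last] by (simp add: norm_mult norm_power)
    also have "\<dots> \<le> S * (C * (real (d * A) * (4 * \<theta> ^ (k + Suc d))) ^ D)"
      using F_le C \<theta> by (intro mult_right_mono) auto
    also have "\<dots> = E * (\<theta> ^ D) ^ k"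
      by (simp add: E_def power_add power_mult_distrib mult_ac flip: power_mult)
    also have "\<dots> \<le> (E + 1) ^ k * (\<theta> ^ D) ^ k"
    proof (intro mult_right_mono)
      show "E \<le> (E + 1) ^ k"
        using E k self_le_power[of "E + 1" k] by simp
    qed (use \<theta> in auto)
    also have "\<dots> = ((E + 1) * \<theta> ^ D) ^ k"
      by (simp add: power_mult_distrib)
    also have "\<dots> < (cmod z ^ M0) ^ k"
      using M0 E \<theta> k by (intro power_strict_mono) auto
    finally show False
      by (simp add: s_def power_mult)
  qed
  then show ?thesis
    using \<delta>(1) by (intro exI[of _ \<delta>] conjI exI[of _ M]) auto
qed

section \<open>The product bound for the Fourier transform\<close>

lemma expectation_prod_coordinates:
  fixes f :: "nat \<Rightarrow> bool \<Rightarrow> complex"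
  assumes p: "0 \<le> p" "p \<le> 1"
  shows "(CLINT \<omega>|sign_space p. \<Prod>i<n. f i (\<omega> i)) = (\<Prod>i<n. of_real p * f i True + of_real (1 - p) * f i False)"
proof -
  let ?B = "\<lambda>_::nat. measure_pmf (bernoulli_pmf p)"
  interpret product_prob_space ?B UNIV
    by standard
  have sp: "sign_space p = PiM UNIV ?B"
    by (simp add: sign_space_def)
  have coord: "(\<lambda>\<omega>. \<omega> i) \<in> measurable (sign_space p) (?B i)" for i
    unfolding sp by (rule measurable_component_singleton) simp
  have dist: "distr (sign_space p) (?B i) (\<lambda>\<omega>. \<omega> i) = ?B i" for i
    unfolding sp by (intro distr_PiM_component) (auto intro: measure_pmf.prob_space_axioms)
  \<comment> \<open>The joint law of the coordinates is the product of their marginals, which is the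
    criterion for independence.\<close>
  have "P.indep_vars ?B (\<lambda>i \<omega>. \<omega> i) UNIV"
    using coord dist unfolding sp by (subst P.indep_vars_iff_distr_eq_PiM) (auto simp: restrict_UNIV)
  then have "P.indep_vars (\<lambda>_. borel) (\<lambda>i \<omega>. f i (\<omega> i)) UNIV"
    by (rule P.indep_vars_compose2) simp
  then have indep: "P.indep_vars (\<lambda>_. borel) (\<lambda>i \<omega>. f i (\<omega> i)) {..<n}"
    by (rule P.indep_vars_subset) simp
  have int: "integrable (?B i) (f i)" for i
    by (rule integrable_measure_pmf_finite) simp
  have "integrable (sign_space p) (\<lambda>\<omega>. f i (\<omega> i))" for i
    using integrable_distr[OF coord, of i "f i"] int[of i] unfolding dist by simp
  then have prod: "(CLINT \<omega>|sign_space p. \<Prod>i<n. f i (\<omega> i)) = (\<Prod>i<n. CLINT \<omega>|sign_space p. f i (\<omega> i))"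
    unfolding sp by (intro P.indep_vars_lebesgue_integral indep) auto
  have "(CLINT \<omega>|sign_space p. f i (\<omega> i)) = of_real p * f i True + of_real (1 - p) * f i False" for i
  proof -
    have "(CLINT \<omega>|sign_space p. f i (\<omega> i)) = (CLINT b|bernoulli_pmf p. f i b)"
      using integral_distr[OF coord, of "f i" i] unfolding dist by simp
    also have "\<dots> = of_real p * f i True + of_real (1 - p) * f i False"
      using p by (subst integral_measure_pmf[of UNIV]) (auto simp: UNIV_bool scaleR_conv_of_real)
    finally show ?thesis .
  qed
  then show ?thesis
    unfolding prod by simp
qed

text \<open>The number has real part \<open>cos x\<close> and imaginary part
  \<open>(1 - 2 * p) * sin x\<close>.\<close>

lemma norm_biased_sign_factor:
  "cmod (of_real p * exp (- (\<i> * of_real x)) + of_real (1 - p) * exp (\<i> * of_real x))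
    = sqrt (1 - 4 * p * (1 - p) * (sin x)\<^sup>2)"
proof -
  have "of_real p * exp (- (\<i> * of_real x)) + of_real (1 - p) * exp (\<i> * of_real x) = Complex (cos x) ((1 - 2 * p) * sin x)"
    by (simp add: exp_eq_polar complex_eq_iff algebra_simps flip: cis_conv_exp)
  moreover have "(cos x)\<^sup>2 + ((1 - 2 * p) * sin x)\<^sup>2 = 1 - 4 * p * (1 - p) * (sin x)\<^sup>2"
    unfolding cos_squared_eq by (simp add: power2_eq_square algebra_simps)
  ultimately show ?thesis
    by (simp add: cmod_def)
qed

lemma prod_initial_segment_mono:
  fixes h :: "nat \<Rightarrow> real"
  assumes h: "\<And>n. 0 \<le> h n \<and> h n \<le> 1" and le: "m \<le> n"
  shows "(\<Prod>i<n. h i) \<le> (\<Prod>i<m. h i)"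
proof -
  have "(\<Prod>i<n. h i) = (\<Prod>i\<in>{..<n} - {..<m}. h i) * (\<Prod>i<m. h i)"
    using le by (intro prod.subset_diff) auto
  also have "\<dots> \<le> 1 * (\<Prod>i<m. h i)"
    using h by (intro mult_right_mono prod_le_1 prod_nonneg) auto
  finally show ?thesis by simp
qed

text \<open>By dominated convergence the transform is the limit of the finite products for the
  partial sums. All factors have modulus at most 1, so each product with at least \<open>N\<close>
  factors is bounded by its first \<open>N\<close>.\<close>

lemma fourier_bernoulli_convolution_le:
  assumes p: "0 < p" "p < 1" and l: "0 < l" "l < 1"
  shows "cmod (fourier_transform (bernoulli_convolution p l) \<xi>)
    \<le> (\<Prod>i<N. sqrt (1 - 4 * p * (1 - p) * (sin (pi * (2 * \<xi> * l ^ i)))\<^sup>2))"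
proof -
  define c :: complex where "c = - (\<i> * of_real (2 * pi * \<xi>))"
  define \<sigma> where "\<sigma> b = (if b then 1 else - 1 :: real)" for b
  define f where "f i b = exp (c * of_real (\<sigma> b * l ^ i))" for i :: nat and b
  define g where "g i = of_real p * f i True + of_real (1 - p) * f i False" for i
  let ?h = "\<lambda>i. sqrt (1 - 4 * p * (1 - p) * (sin (pi * (2 * \<xi> * l ^ i)))\<^sup>2)"
  have g: "cmod (g i) = ?h i" for i
    using norm_biased_sign_factor[of p "pi * (2 * \<xi> * l ^ i)"]
    by (simp add: g_def f_def c_def \<sigma>_def mult_ac)
  have h: "0 \<le> ?h i \<and> ?h i \<le> 1" for i
  proof
    \<comment> \<open>In HOL \<open>sqrt\<close> is negative on negative arguments; nonnegativity
      follows by reading the root as a norm.\<close>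
    show "0 \<le> ?h i"
      unfolding g[symmetric] by (rule norm_ge_zero)
    show "?h i \<le> 1"
      using p by (simp add: mult_nonneg_nonneg)
  qed
  have expand: "exp (c * of_real (\<Sum>i<n. \<sigma> (\<omega> i) * l ^ i)) = (\<Prod>i<n. f i (\<omega> i))" for n \<omega>
    by (simp add: f_def exp_sum sum_distrib_left)
  have norm_exp: "cmod (exp (c * of_real x)) = 1" for x
    by (simp add: c_def)
  have series: "(\<lambda>n. \<Sum>i<n. \<sigma> (\<omega> i) * l ^ i) \<longlonglongrightarrow> random_series l \<omega>" for \<omega>
  proof -
    have "summable (\<lambda>i. \<sigma> (\<omega> i) * l ^ i)"
      using l by (intro summable_comparison_test'[OF summable_geometric[of l]]) (auto simp: \<sigma>_def)
    then show ?thesis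
      unfolding random_series_def \<sigma>_def by (rule summable_LIMSEQ)
  qed
  interpret product_prob_space "\<lambda>_::nat. measure_pmf (bernoulli_pmf p)" UNIV
    by standard
  have meas: "(\<lambda>\<omega>. \<Sum>i<n. \<sigma> (\<omega> i) * l ^ i) \<in> borel_measurable (sign_space p)" for n
    unfolding sign_space_def \<sigma>_def by measurable
  have "(\<lambda>n. CLINT \<omega>|sign_space p. exp (c * of_real (\<Sum>i<n. \<sigma> (\<omega> i) * l ^ i)))
      \<longlonglongrightarrow> (CLINT \<omega>|sign_space p. exp (c * of_real (random_series l \<omega>)))"
  proof (rule integral_dominated_convergence[where w = "\<lambda>_. 1"])
    show "(\<lambda>\<omega>. exp (c * of_real (\<Sum>i<n. \<sigma> (\<omega> i) * l ^ i))) \<in> borel_measurable (sign_space p)" for n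
      using meas[of n] by measurable
    show "(\<lambda>\<omega>. exp (c * of_real (random_series l \<omega>))) \<in> borel_measurable (sign_space p)"
      by measurable
    show "integrable (sign_space p) (\<lambda>_. 1 :: real)"
      unfolding sign_space_def by simp
    show "AE \<omega> in sign_space p. (\<lambda>n. exp (c * of_real (\<Sum>i<n. \<sigma> (\<omega> i) * l ^ i)))
        \<longlonglongrightarrow> exp (c * of_real (random_series l \<omega>))"
      by (intro AE_I2 tendsto_intros series)
    show "AE \<omega> in sign_space p. cmod (exp (c * of_real (\<Sum>i<n. \<sigma> (\<omega> i) * l ^ i))) \<le> 1" for n
      by (intro AE_I2) (simp only: norm_exp order.refl)
  qed
  also have "(CLINT \<omega>|sign_space p. exp (c * of_real (random_series l \<omega>))) = fourier_transform (bernoulli_convolution p l) \<xi>"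
    unfolding fourier_transform_def bernoulli_convolution_def
    by (subst integral_distr) (auto simp: c_def mult_ac)
  finally have "(\<lambda>n. \<Prod>i<n. g i) \<longlonglongrightarrow> fourier_transform (bernoulli_convolution p l) \<xi>"
    using p by (simp only: expand expectation_prod_coordinates[OF less_imp_le less_imp_le] g_def)
  then have "(\<lambda>n. cmod (\<Prod>i<n. g i)) \<longlonglongrightarrow> cmod (fourier_transform (bernoulli_convolution p l) \<xi>)"
    by (rule tendsto_norm)
  then show ?thesis
  proof (rule LIMSEQ_le_const2)
    have "cmod (\<Prod>i<n. g i) \<le> (\<Prod>i<N. ?h i)" if "n \<ge> N" for n
    proof -
      have "cmod (\<Prod>i<n. g i) = (\<Prod>i<n. ?h i)"
        unfolding prod_norm[symmetric] g ..
      also have "\<dots> \<le> (\<Prod>i<N. ?h i)"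
        using that h by (intro prod_initial_segment_mono) auto
      finally show ?thesis .
    qed
    then show "\<exists>N'. \<forall>n\<ge>N'. cmod (\<Prod>i<n. g i) \<le> (\<Prod>i<N. ?h i)"
      by blast
  qed
qed

text \<open>The square of \<open>sin (pi * t)\<close> depends only on the distance from
  \<open>t\<close> to the nearest integer, and increases with it on \<open>[0, 1/2]\<close>. Passing
  to the doubled angle avoids the sign change of the sine under integer shifts.\<close>

lemma sin_squared_ge_of_far_from_integers:
  assumes "0 \<le> \<delta>" "\<delta> \<le> \<bar>t - of_int (round t)\<bar>"
  shows "(sin (pi * \<delta>))\<^sup>2 \<le> (sin (pi * t))\<^sup>2"
proof -
  define r where "r = t - of_int (round t)"
  have "cos (2 * (pi * t)) = cos (2 * (pi * t) - of_int (round t) * (2 * pi))"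
    using cos.minus_of_int[of "2 * (pi * t)" "round t"] by simp
  also have "\<dots> = cos (2 * (pi * r))"
    by (simp add: r_def algebra_simps)
  also have "\<dots> = cos (2 * (pi * \<bar>r\<bar>))"
    by (cases "r \<ge> 0") simp_all
  finally have eq: "(sin (pi * t))\<^sup>2 = (sin (pi * \<bar>r\<bar>))\<^sup>2"
    unfolding cos_double_sin by simp
  have "\<bar>r\<bar> \<le> 1 / 2"
    unfolding r_def using of_int_round_abs_le[of t] by (simp add: abs_minus_commute)
  then have "sin (pi * \<delta>) \<le> sin (pi * \<bar>r\<bar>)"
    using assms unfolding r_def[symmetric] by (intro sin_monotone_2pi_le) (auto intro: order_trans[of _ 0])
  moreover have "0 \<le> sin (pi * \<delta>)"
    using assms \<open>\<bar>r\<bar> \<le> 1 / 2\<close> unfolding r_def[symmetric] by (intro sin_ge_zero) auto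
  ultimately show ?thesis
    unfolding eq by (intro power_mono)
qed

text \<open>Each of the \<open>J\<close> disjoint blocks from \<open>b ^ i\<close> up to
  \<open>b ^ Suc i\<close> with \<open>i < J\<close> contains a factor at most
  \<open>\<rho>\<close>; the other factors are at most 1.\<close>

lemma prod_le_power_of_geometric_hits:
  fixes h :: "nat \<Rightarrow> real"
  assumes h: "\<And>n. 0 \<le> h n \<and> h n \<le> 1"
    and hit: "\<And>k. k \<ge> 1 \<Longrightarrow> \<exists>n\<in>{k..<b * k}. h n \<le> \<rho>" and b: "b \<ge> 1"
  shows "(\<Prod>n<b ^ J. h n) \<le> \<rho> ^ J"
proof (induction J)
  case 0
  then show ?case using h[of 0] by simp
next
  case (Suc J)
  obtain n where n: "b ^ J \<le> n" "n < b * b ^ J" "h n \<le> \<rho>"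
    using hit[of "b ^ J"] b by auto
  let ?D = "{..<b ^ Suc J} - {..<b ^ J}"
  have "(\<Prod>i\<in>?D. h i) = h n * (\<Prod>i\<in>?D - {n}. h i)"
    using n by (intro prod.remove) auto
  also have "\<dots> \<le> h n"
    using h by (intro mult_left_le prod_le_1) auto
  finally have D: "(\<Prod>i\<in>?D. h i) \<le> \<rho>"
    using n(3) by linarith
  have "(\<Prod>i<b ^ Suc J. h i) = (\<Prod>i\<in>?D. h i) * (\<Prod>i<b ^ J. h i)"
    using b by (intro prod.subset_diff) auto
  also have "\<dots> \<le> \<rho> * \<rho> ^ J"
    using order_trans[of 0 "h n" \<rho>] n(3) h by (intro mult_mono D Suc.IH prod_nonneg) auto
  finally show ?case by simp
qed

lemma geometric_bracket:
  fixes \<theta> x :: real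
  assumes "\<theta> > 1" "x \<ge> 1"
  obtains n where "\<theta> ^ n \<le> x" "x < \<theta> ^ Suc n"
proof -
  define m where "m = (LEAST m. x < \<theta> ^ m)"
  have m: "x < \<theta> ^ m"
    unfolding m_def using real_arch_pow[OF assms(1), of x] by (rule LeastI_ex)
  then obtain n where n: "m = Suc n"
    using assms(2) by (cases m) auto
  then have "\<not> x < \<theta> ^ n"
    unfolding m_def by (metis lessI not_less_Least)
  then show ?thesis
    using that[of n] m n by simp
qed

text \<open>Makes \<open>ln (2 + \<bar>\<xi>\<bar>)\<close> at most linear in the number of
  factors.\<close>

lemma two_plus_power_le:
  fixes x :: real
  assumes "x \<ge> 0"
  shows "2 + x ^ Suc n \<le> (2 + x) ^ Suc n"
proof (induction n)
  case (Suc n)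
  have "2 + x ^ Suc (Suc n) \<le> (2 + x) * (2 + x ^ Suc n)"
    using assms by (simp add: algebra_simps)
  also have "\<dots> \<le> (2 + x) * (2 + x) ^ Suc n"
    using assms by (intro mult_left_mono Suc) auto
  finally show ?case by simp
qed simp

section \<open>Logarithmic decay\<close>

theorem corollary8p3:
  fixes \<theta> l :: real
  assumes "\<theta> > 1" and "algebraic_int \<theta>"
    and "\<exists>z. galois_conjugate (of_real \<theta>) z \<and> z \<noteq> of_real \<theta> \<and> cmod z > 1"
    and "l = inverse \<theta>"
  shows "\<forall>p::real. 0 < p \<and> p < 1 \<longrightarrow>
           (\<exists>\<alpha>>0. bdd_above (range (\<lambda>\<xi>::real.
              cmod (fourier_transform (bernoulli_convolution p l) \<xi>) * ln (2 + \<bar>\<xi>\<bar>) powr \<alpha>)))"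
proof (intro allI impI)
  fix p :: real
  assume p: "0 < p \<and> p < 1"
  have l: "0 < l" "l < 1"
    using assms(1,4) by (auto simp: inverse_less_1_iff)
  have int: "algebraic_int (of_real \<theta> :: complex)"
    using assms(2) by (rule algebraic_int_of_real)
  obtain \<delta> M where \<delta>: "\<delta> > 0" and far: "\<And>y k. y \<in> {1..\<theta>} \<Longrightarrow> k \<ge> 1 \<Longrightarrow>
      \<exists>n\<in>{k..M * k}. \<delta> \<le> \<bar>\<theta> ^ n * y - of_int (round (\<theta> ^ n * y))\<bar>"
    using powers_far_from_integers[OF assms(1) int] assms(3) by blast
  \<comment> \<open>The half-open block up to \<open>b * k\<close> contains
    \<open>{k..M * k}\<close> for \<open>k \<ge> 1\<close>, and \<open>b \<ge> 2\<close> makes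
    \<open>ln b\<close> positive.\<close>
  define b where "b = M + 2"
  define h where "h t = sqrt (1 - 4 * p * (1 - p) * (sin (pi * t))\<^sup>2)" for t
  \<comment> \<open>The cap at 1/2 keeps \<open>sin (pi * \<delta>')\<close> positive.\<close>
  define \<delta>' where "\<delta>' = min \<delta> (1 / 2)"
  \<comment> \<open>\<open>h \<delta>'\<close> may be zero, as for \<open>p = 1/2\<close> and
    \<open>\<delta>' = 1/2\<close>; the maximum makes \<open>ln \<rho>\<close> meaningful.\<close>
  define \<rho> where "\<rho> = max (1 / 2) (h \<delta>')"
  \<comment> \<open>Solves \<open>b powr \<alpha> = 1 / \<rho>\<close>, so that the decay
    \<open>\<rho> ^ J\<close> cancels the growth of \<open>(b ^ J) powr \<alpha>\<close>.\<close>
  define \<alpha> where "\<alpha> = - ln \<rho> / ln (real b)"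
  define L where "L = ln (2 + \<theta>)"
  have h: "0 \<le> h t \<and> h t \<le> 1" for t
  proof -
    have "0 \<le> h t"
      unfolding h_def norm_biased_sign_factor[symmetric] by (rule norm_ge_zero)
    moreover have "h t \<le> 1"
      using p by (simp add: h_def)
    ultimately show ?thesis by blast
  qed
  have "0 < sin (pi * \<delta>')"
    using \<delta> pi_gt_zero by (intro sin_gt_zero) (auto simp: \<delta>'_def min_def)
  then have "h \<delta>' < 1"
    using p by (simp add: h_def)
  then have \<rho>: "0 < \<rho>" "\<rho> < 1"
    by (auto simp: \<rho>_def)
  have b: "real b \<ge> 2"
    by (simp add: b_def)
  have \<alpha>: "\<alpha> > 0"
    using \<rho> b by (simp add: \<alpha>_def field_simps)
  have b_\<alpha>: "real b powr \<alpha> = 1 / \<rho>"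
    using \<rho> b by (simp add: \<alpha>_def powr_def exp_minus field_simps)
  have ln3: "ln 3 \<le> L"
    using assms(1) by (simp add: L_def)
  have L: "L > 0"
    using assms(1) by (simp add: L_def)
  have h_even: "h (- t) = h t" for t
    by (simp add: h_def)
  have "cmod (fourier_transform (bernoulli_convolution p l) \<xi>) * ln (2 + \<bar>\<xi>\<bar>) powr \<alpha> \<le> (b * L) powr \<alpha>" for \<xi>
  proof -
    have FT: "cmod (fourier_transform (bernoulli_convolution p l) \<xi>) \<le> (\<Prod>i<N. h (2 * \<xi> * l ^ i))" for N
      using fourier_bernoulli_convolution_le[of p l \<xi> N] p l by (simp add: h_def)
    show ?thesis
    proof (cases "2 * \<bar>\<xi>\<bar> < 1")
      \<comment> \<open>For small \<open>\<xi>\<close> the empty product gives the bound 1, and the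
        logarithm is at most \<open>ln 3\<close>.\<close>
      case True
      then have "ln (2 + \<bar>\<xi>\<bar>) \<le> ln 3"
        by auto
      moreover have "L \<le> b * L"
        using b L by simp
      ultimately have "ln (2 + \<bar>\<xi>\<bar>) \<le> b * L"
        using ln3 by linarith
      then have "ln (2 + \<bar>\<xi>\<bar>) powr \<alpha> \<le> (b * L) powr \<alpha>"
        using \<alpha> by (intro powr_mono2) auto
      then have "cmod (fourier_transform (bernoulli_convolution p l) \<xi>) * ln (2 + \<bar>\<xi>\<bar>) powr \<alpha> \<le> 1 * (b * L) powr \<alpha>"
        using FT[of 0] by (intro mult_mono) auto
      then show ?thesis by simp
    next
      case False
      then obtain N where N: "\<theta> ^ N \<le> 2 * \<bar>\<xi>\<bar>" "2 * \<bar>\<xi>\<bar> < \<theta> ^ Suc N"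
        using geometric_bracket[of \<theta> "2 * \<bar>\<xi>\<bar>"] assms(1) by auto
      define y where "y = 2 * \<bar>\<xi>\<bar> / \<theta> ^ N"
      have \<theta>N: "\<theta> ^ N > 0"
        using assms(1) by simp
      have y: "y \<in> {1..\<theta>}"
        using N \<theta>N by (auto simp: y_def field_simps)
      \<comment> \<open>Counting the factors backwards turns negative powers of
        \<open>\<theta>\<close> into the sequence \<open>\<theta> ^ n * y\<close>; evenness of
        \<open>h\<close> absorbs the sign of \<open>\<xi>\<close>.\<close>
      have arg: "h (2 * \<xi> * l ^ i) = h (\<theta> ^ (N - i) * y)" if "i \<le> N" for i
      proof -
        have "\<theta> ^ N = \<theta> ^ i * \<theta> ^ (N - i)"
          using that by (simp flip: power_add)
        moreover have "l ^ i = 1 / \<theta> ^ i"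
          using assms(4) by (simp add: power_inverse divide_inverse)
        ultimately have "\<theta> ^ (N - i) * y = 2 * \<bar>\<xi>\<bar> * l ^ i"
          using assms(1) by (simp add: y_def)
        then show ?thesis
          using h_even[of "2 * \<xi> * l ^ i"] by (cases "\<xi> \<ge> 0") auto
      qed
      have "(\<Prod>i<Suc N. h (2 * \<xi> * l ^ i)) = (\<Prod>i<Suc N. h (\<theta> ^ (Suc N - Suc i) * y))"
        using arg by (intro prod.cong) auto
      also have "\<dots> = (\<Prod>n<Suc N. h (\<theta> ^ n * y))"
        by (rule prod.nat_diff_reindex)
      finally have FT': "cmod (fourier_transform (bernoulli_convolution p l) \<xi>) \<le> (\<Prod>n<Suc N. h (\<theta> ^ n * y))"
        using FT[of "Suc N"] by simp
      \<comment> \<open>The lower bracket yields \<open>J\<close> complete blocks below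
        \<open>Suc N\<close>; the upper one bounds the logarithm, at the cost of the factor
        \<open>b\<close> in the final constant.\<close>
      obtain J where J: "real b ^ J \<le> real (Suc N)" "real (Suc N) < real b ^ Suc J"
        using geometric_bracket[of "real b" "real (Suc N)"] b by auto
      have hit: "\<exists>n\<in>{k..<b * k}. h (\<theta> ^ n * y) \<le> \<rho>" if k: "k \<ge> 1" for k
      proof -
        obtain n where n: "k \<le> n" "n \<le> M * k" "\<delta> \<le> \<bar>\<theta> ^ n * y - of_int (round (\<theta> ^ n * y))\<bar>"
          using far[OF y k] by auto
        have "(sin (pi * \<delta>'))\<^sup>2 \<le> (sin (pi * (\<theta> ^ n * y)))\<^sup>2"
          using n(3) \<delta> by (intro sin_squared_ge_of_far_from_integers) (auto simp: \<delta>'_def)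
        then have "h (\<theta> ^ n * y) \<le> h \<delta>'"
          using p by (simp add: h_def)
        moreover have "n < b * k"
          using n(2) k by (simp add: b_def algebra_simps)
        ultimately show ?thesis
          using n(1) by (intro bexI[of _ n]) (auto simp: \<rho>_def)
      qed
      have "b ^ J \<le> Suc N"
        using J(1) by (metis of_nat_le_iff of_nat_power)
      then have "(\<Prod>n<Suc N. h (\<theta> ^ n * y)) \<le> (\<Prod>n<b ^ J. h (\<theta> ^ n * y))"
        using h by (intro prod_initial_segment_mono) auto
      also have "\<dots> \<le> \<rho> ^ J"
        using h hit by (intro prod_le_power_of_geometric_hits) (auto simp: b_def)
      finally have FT_le: "cmod (fourier_transform (bernoulli_convolution p l) \<xi>) \<le> \<rho> ^ J"
        using FT' by linarith
      have "2 + \<bar>\<xi>\<bar> \<le> (2 + \<theta>) ^ Suc N"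
        using N(2) two_plus_power_le[of \<theta> N] assms(1) by linarith
      then have "ln (2 + \<bar>\<xi>\<bar>) \<le> ln ((2 + \<theta>) ^ Suc N)"
        using assms(1) by (intro ln_mono) auto
      also have "\<dots> = real (Suc N) * L"
        using assms(1) by (simp only: L_def ln_realpow)
      also have "\<dots> \<le> real b ^ J * (b * L)"
        using J(2) L mult_right_mono[of "real (Suc N)" "real b ^ Suc J" L] by (simp add: mult_ac)
      finally have "ln (2 + \<bar>\<xi>\<bar>) powr \<alpha> \<le> (real b ^ J * (b * L)) powr \<alpha>"
        using \<alpha> by (intro powr_mono2) auto
      also have "\<dots> = (1 / \<rho>) ^ J * (b * L) powr \<alpha>"
        using b L b_\<alpha> by (simp add: powr_mult powr_power powr_powr mult.commute flip: powr_realpow b_\<alpha>)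
      finally have "cmod (fourier_transform (bernoulli_convolution p l) \<xi>) * ln (2 + \<bar>\<xi>\<bar>) powr \<alpha>
          \<le> \<rho> ^ J * ((1 / \<rho>) ^ J * (b * L) powr \<alpha>)"
        using FT_le \<rho> by (intro mult_mono) auto
      also have "\<dots> = (b * L) powr \<alpha>"
        using \<rho> by (simp add: power_one_over field_simps)
      finally show ?thesis .
    qed
  qed
  then have "bdd_above (range (\<lambda>\<xi>. cmod (fourier_transform (bernoulli_convolution p l) \<xi>) * ln (2 + \<bar>\<xi>\<bar>) powr \<alpha>))"
    by (intro bdd_aboveI2)
  then show "\<exists>\<alpha>>0. bdd_above (range (\<lambda>\<xi>::real.
      cmod (fourier_transform (bernoulli_convolution p l) \<xi>) * ln (2 + \<bar>\<xi>\<bar>) powr \<alpha>))"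
    using \<alpha> by blast
qed

end
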